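(* Let $a>b>0$, $c=\sqrt{a^2-b^2}$, and let $\mathcal{E}$ be the ellipse $(x/a)^2+(y/b)^2=1$. The circle centered at the focus $C_1=[c,0]$ of $\mathcal{E}$ with radius $$r_1=\frac{b^2}{c^2}\left(\sqrt{a^2+c^2}-a\right)$$ is a caustic admitting a Poncelet family of triangles inscribed in $\mathcal{E}$ (the circle being the fixed incircle of the triangles).
   Context: Points of the plane are written $[x,y]$. Given an ellipse $\mathcal{E}$ and a conic $\mathcal{K}$, we say that $\mathcal{K}$ is a caustic admitting a Poncelet family of triangles inscribed in $\mathcal{E}$ if every point of $\mathcal{E}$ is a vertex of a triangle whose three vertices lie on $\mathcal{E}$ and whose three sidelines are tangent to $\mathcal{K}$; the Poncelet family is the set of all such triangles. *)

theory Defs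
  imports "HOL-Analysis.Analysis"
begin

type_synonym point = "real \<times> real"

definition homogeneous :: "point \<Rightarrow> real ^ 3" where
  "homogeneous p = vector [fst p, snd p, 1]"

text \<open>
  A conic is the nonempty real zero set of a quadratic polynomial, given by a symmetric
  invertible matrix acting on the homogeneous coordinates of a point.
\<close>

definition conic_matrix :: "real ^ 3 ^ 3 \<Rightarrow> point set \<Rightarrow> bool" where
  "conic_matrix M K \<longleftrightarrow>
     transpose M = M \<and> invertible M \<and> K \<noteq> {} \<and>
     K = {p. homogeneous p \<bullet> (M *v homogeneous p) = 0}"

definition conic_section :: "point set \<Rightarrow> bool" where
  "conic_section K \<longleftrightarrow> (\<exists>M. conic_matrix M K)"

text \<open>
  For a point \<open>p\<close> of the conic with quadratic polynomial \<open>q\<close> one has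
  \<open>grad q p \<bullet> (z - p) = 2 * (homogeneous z \<bullet> (M *v homogeneous p))\<close>, so the set below is the
  tangent line at \<open>p\<close>. Only points of contact in the affine plane are considered, so an
  asymptote of a hyperbola does not count as a tangent.
  The matrix of a conic is unique up to a nonzero factor, so its choice is immaterial.
\<close>

definition tangent_line :: "point set \<Rightarrow> point set \<Rightarrow> bool" where
  "tangent_line K L \<longleftrightarrow>
     (\<exists>M. conic_matrix M K \<and>
       (\<exists>p\<in>K. L = {z. homogeneous z \<bullet> (M *v homogeneous p) = 0}))"

definition ellipse :: "real \<Rightarrow> real \<Rightarrow> point set" where
  "ellipse a b = {(x, y). (x / a)\<^sup>2 + (y / b)\<^sup>2 = 1}"

text \<open>A triangle is represented by its set of vertices.\<close>

definition triangle :: "point set \<Rightarrow> bool" where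
  "triangle T \<longleftrightarrow> card T = 3 \<and> \<not> collinear T"

definition sidelines_tangent :: "point set \<Rightarrow> point set \<Rightarrow> bool" where
  "sidelines_tangent T K \<longleftrightarrow>
     (\<forall>P\<in>T. \<forall>Q\<in>T. P \<noteq> Q \<longrightarrow> tangent_line K (affine hull {P, Q}))"

definition poncelet_family :: "point set \<Rightarrow> point set \<Rightarrow> point set set" where
  "poncelet_family E K = {T. triangle T \<and> T \<subseteq> E \<and> sidelines_tangent T K}"

definition poncelet_caustic :: "point set \<Rightarrow> point set \<Rightarrow> bool" where
  "poncelet_caustic E K \<longleftrightarrow>
     conic_section K \<and> (\<forall>P\<in>E. \<exists>T\<in>poncelet_family E K. P \<in> T)"

text \<open>Containment in the triangle distinguishes the incircle from the three excircles.\<close>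

definition incircle :: "point set \<Rightarrow> point set \<Rightarrow> bool" where
  "incircle T S \<longleftrightarrow>
     (\<exists>C r. r > 0 \<and> S = sphere C r) \<and> S \<subseteq> convex hull T \<and> sidelines_tangent T S"

end

theory Submission
  imports Defs
begin

text \<open>
  Put the origin at the focus \<open>C\<close>. With \<open>e = c / a\<close> and \<open>p = b\<^sup>2 / a\<close> the ellipse is
  the set of points whose distance from \<open>C\<close> is \<open>p - e * X\<close>, where \<open>X\<close> is the first
  coordinate, so each of its points is determined by its direction \<open>u\<close>, a unit vector, seen from
  \<open>C\<close>. The map from a point to its direction is the restriction of a projective map
  that takes the ellipse to the unit circle and lines to lines, and it takes the tangents of a
  circle about \<open>C\<close> to the tangents of a conic with one focus at the origin.

  For the given radius the second focus of that conic is \<open>orthocentre = (h, 0)\<close> with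
  \<open>e * h\<^sup>2 + 2 * h = e\<close>, and its major axis has length \<open>1\<close>, the radius of the
  unit circle. A line is tangent to such an ellipse exactly if the mirror image of one focus in the
  line has distance \<open>1\<close> from the other focus. The mirror image of the origin in the chord
  through two unit vectors \<open>u\<close> and \<open>v\<close> is \<open>u + v\<close>. Hence a chord of the
  given ellipse is tangent to the circle exactly if its directions satisfy
  \<open>norm (orthocentre - (u + v)) = 1\<close>, which says that \<open>w = orthocentre - (u + v)\<close>
  is again a unit vector.

  The condition \<open>u + v + w = orthocentre\<close> is symmetric in the three directions, and this is
  why the Poncelet triangles close. It says that the triangle of directions, whose circumcentre
  is the origin, has its orthocentre at the second focus. Every unit vector \<open>w\<close> extends to
  such a triple (\<open>ex_sum_eq_orthocentre\<close>), every such triple gives a triangle with the circle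
  as incircle (\<open>triangle_of_sum_eq_orthocentre\<close>), and all triangles of the family arise so
  (\<open>sum_eq_orthocentre_of_triangle\<close>). The circle is the incircle and not an excircle because
  \<open>h < 1\<close>: the orthocentre lies inside the circumcircle, so the triangle of directions is acute
  and contains its circumcentre, which corresponds to \<open>C\<close>.
\<close>

section \<open>Lines and triangles in the plane\<close>

lemma parallel_if_orthogonal_to_same:
  fixes d x y :: point
  assumes "d \<noteq> 0" "d \<bullet> x = 0" "d \<bullet> y = 0" "y \<noteq> 0"
  shows "\<exists>t. x = t *\<^sub>R y"
proof -
  obtain d1 d2 x1 x2 y1 y2 where [simp]: "d = (d1, d2)" "x = (x1, x2)" "y = (y1, y2)"
    by (metis surj_pair)
  have eqs: "d1 * x1 + d2 * x2 = 0" "d1 * y1 + d2 * y2 = 0" using assms by auto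
  have "d1 * (x1 * y2 - x2 * y1) = 0" "d2 * (x1 * y2 - x2 * y1) = 0"
    using eqs by algebra+
  then have det: "x1 * y2 = x2 * y1" using assms(1) by (auto simp: zero_prod_def)
  show ?thesis
  proof (cases "y1 = 0")
    case True
    then have "x = (x2 / y2) *\<^sub>R y" using det assms(4) by (auto simp: zero_prod_def)
    then show ?thesis ..
  next
    case False
    then have "x = (x1 / y1) *\<^sub>R y" using det by (auto simp: field_simps)
    then show ?thesis ..
  qed
qed

lemma affine_hull_2_eq_line:
  fixes P Q n :: point
  assumes "P \<noteq> Q" "n \<noteq> 0" "n \<bullet> (P - C) = r" "n \<bullet> (Q - C) = r"
  shows "affine hull {P, Q} = {z. n \<bullet> (z - C) = r}"
proof (intro equalityI subsetI)
  fix z assume "z \<in> affine hull {P, Q}"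
  then obtain u v where "z = u *\<^sub>R P + v *\<^sub>R Q" and uv: "u + v = 1"
    unfolding affine_hull_2 by blast
  then have "z - C = u *\<^sub>R (P - C) + v *\<^sub>R (Q - C)"
    by (simp add: algebra_simps flip: scaleR_left_distrib)
  then show "z \<in> {z. n \<bullet> (z - C) = r}"
    using assms(3,4) uv by (simp add: inner_add_right flip: distrib_right)
next
  fix z assume "z \<in> {z. n \<bullet> (z - C) = r}"
  then have "n \<bullet> (z - P) = 0" "n \<bullet> (Q - P) = 0"
    using assms(3,4) by (auto simp: inner_diff_right)
  then obtain t where "z - P = t *\<^sub>R (Q - P)"
    using parallel_if_orthogonal_to_same[of n "z - P" "Q - P"] assms(1,2) by auto
  then have "z = (1 - t) *\<^sub>R P + t *\<^sub>R Q" by (simp add: algebra_simps)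
  then show "z \<in> affine hull {P, Q}" unfolding affine_hull_2
    by (intro CollectI exI[of _ "1 - t"] exI[of _ t]) auto
qed

text \<open>
  A point of the disc lies on the inner side of each of the three supporting lines of the triangle.
  Evaluating the functional of one side at the point in barycentric coordinates leaves only the
  coordinate of the opposite vertex, which is therefore nonnegative.
\<close>

lemma cball_subset_convex_hull_3:
  fixes P Q S :: point
  assumes "\<not> collinear {P, Q, S}"
    and "norm l = 1" "l \<bullet> (Q - C) = r" "l \<bullet> (S - C) = r" "l \<bullet> (P - C) < r"
    and "norm m = 1" "m \<bullet> (S - C) = r" "m \<bullet> (P - C) = r" "m \<bullet> (Q - C) < r"
    and "norm n = 1" "n \<bullet> (P - C) = r" "n \<bullet> (Q - C) = r" "n \<bullet> (S - C) < r"
  shows "cball C r \<subseteq> convex hull {P, Q, S}"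
proof
  fix z assume "z \<in> cball C r"
  then have z: "k \<bullet> (z - C) \<le> r" if "norm k = 1" for k
    using norm_cauchy_schwarz[of k "z - C"] that by (simp add: dist_norm norm_minus_commute)
  have "\<not> affine_dependent {P, Q, S}" "card {P, Q, S} = Suc DIM(point)"
    using assms(1) by (auto simp: collinear_3_eq_affine_dependent)
  then have "z \<in> affine hull {P, Q, S}" by (simp add: affine_independent_span_eq)
  then obtain \<alpha> \<beta> \<gamma> where sum1: "\<alpha> + \<beta> + \<gamma> = 1"
    and zeq: "z = \<alpha> *\<^sub>R P + \<beta> *\<^sub>R Q + \<gamma> *\<^sub>R S"
    unfolding affine_hull_3 by blast
  have "C = \<alpha> *\<^sub>R C + \<beta> *\<^sub>R C + \<gamma> *\<^sub>R C"
    using sum1 by (simp flip: scaleR_add_left)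
  then have "z - C = \<alpha> *\<^sub>R (P - C) + \<beta> *\<^sub>R (Q - C) + \<gamma> *\<^sub>R (S - C)"
    unfolding zeq by (simp add: algebra_simps)
  then have inner: "k \<bullet> (z - C) = \<alpha> * (k \<bullet> (P - C)) + \<beta> * (k \<bullet> (Q - C)) + \<gamma> * (k \<bullet> (S - C))" for k
    by (simp only: inner_add_right inner_scaleR_right)
  have nonneg: "\<mu> \<ge> 0" if "\<mu> * t + (1 - \<mu>) * r \<le> r" "t < r" for \<mu> t :: real
  proof -
    have "\<mu> * (r - t) \<ge> 0" using that(1) by (simp add: algebra_simps)
    then show ?thesis using that(2) by (simp add: zero_le_mult_iff)
  qed
  have "\<alpha> \<ge> 0"
  proof (rule nonneg[OF _ assms(5)])
    have "1 - \<alpha> = \<beta> + \<gamma>" using sum1 by simp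
    then show "\<alpha> * (l \<bullet> (P - C)) + (1 - \<alpha>) * r \<le> r"
      using z[OF assms(2)] inner[of l] assms(3,4) by (simp add: distrib_right)
  qed
  moreover have "\<beta> \<ge> 0"
  proof (rule nonneg[OF _ assms(9)])
    have "1 - \<beta> = \<alpha> + \<gamma>" using sum1 by simp
    then show "\<beta> * (m \<bullet> (Q - C)) + (1 - \<beta>) * r \<le> r"
      using z[OF assms(6)] inner[of m] assms(7,8) by (simp add: distrib_right)
  qed
  moreover have "\<gamma> \<ge> 0"
  proof (rule nonneg[OF _ assms(13)])
    have "1 - \<gamma> = \<alpha> + \<beta>" using sum1 by simp
    then show "\<gamma> * (n \<bullet> (S - C)) + (1 - \<gamma>) * r \<le> r"
      using z[OF assms(10)] inner[of n] assms(11,12) by (simp add: distrib_right)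
  qed
  ultimately show "z \<in> convex hull {P, Q, S}"
    using sum1 unfolding zeq convex_hull_3 by blast
qed

section \<open>Tangent lines of a circle\<close>

text \<open>
  The polarization of the quadratic polynomial of the conic with matrix \<open>M\<close>. For a fixed point
  \<open>p\<close> on the conic its zero set is the tangent line at \<open>p\<close>.
\<close>

definition polar_form :: "real ^ 3 ^ 3 \<Rightarrow> point \<Rightarrow> point \<Rightarrow> real" where
  "polar_form M z p = homogeneous z \<bullet> (M *v homogeneous p)"

lemma polar_form_coords:
  "polar_form M (x, y) (x', y') =
     M$1$1 * x * x' + M$1$2 * x * y' + M$1$3 * x + M$2$1 * y * x' + M$2$2 * y * y' + M$2$3 * y
     + M$3$1 * x' + M$3$2 * y' + M$3$3"
  by (simp add: polar_form_def homogeneous_def inner_vec_def sum_3 matrix_vector_mult_def vector_3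
      algebra_simps)

definition circle_matrix :: "point \<Rightarrow> real \<Rightarrow> real ^ 3 ^ 3" where
  "circle_matrix C r = vector [vector [1, 0, - fst C], vector [0, 1, - snd C],
     vector [- fst C, - snd C, C \<bullet> C - r\<^sup>2]]"

lemma polar_form_circle_matrix:
  "polar_form (circle_matrix C r) z p = (z - C) \<bullet> (p - C) - r\<^sup>2"
  by (cases z; cases p; cases C) (simp add: polar_form_coords circle_matrix_def vector_3 algebra_simps)

lemma conic_matrix_circle:
  assumes "r > 0"
  shows "conic_matrix (circle_matrix C r) (sphere C r)"
proof -
  have "transpose (circle_matrix C r) = circle_matrix C r"
    by (simp add: vec_eq_iff forall_3 transpose_def circle_matrix_def vector_3)
  moreover have "det (circle_matrix C r) = - r\<^sup>2"
    by (cases C) (simp add: det_3 circle_matrix_def vector_3 power2_eq_square algebra_simps)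
  moreover have "sphere C r = {p. polar_form (circle_matrix C r) p p = 0}"
    using assms unfolding polar_form_circle_matrix
    by (auto simp: dist_norm norm_minus_commute dot_square_norm)
  moreover have "sphere C r \<noteq> {}" using assms by simp
  ultimately show ?thesis
    using assms by (simp add: conic_matrix_def invertible_det_nz polar_form_def)
qed

text \<open>
  Tangent lines are defined through an arbitrary matrix of the conic, so that the tangents of a circle
  are known only once all matrices of the circle are. Evaluating the quadratic polynomial at five
  points of the circle determines its coefficients up to a common factor \<open>k\<close>.
\<close>

lemma conic_matrix_circle_unique:
  assumes "r > 0" "conic_matrix M (sphere C r)"
  obtains k where "k \<noteq> 0" "\<And>z p. polar_form M z p = k * ((z - C) \<bullet> (p - C) - r\<^sup>2)"
proof -
  obtain x0 y0 where C: "C = (x0, y0)" by (cases C)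
  have tM: "transpose M = M"
    and K: "sphere C r = {p. polar_form M p p = 0}"
    using assms(2) by (auto simp: conic_matrix_def polar_form_def)
  have "M$i$j = M$j$i" for i j
    using arg_cong[OF tM, of "\<lambda>A. A$j$i"] by (simp add: transpose_def)
  then have sym: "M$2$1 = M$1$2" "M$3$1 = M$1$3" "M$3$2 = M$2$3" by blast+
  have on: "polar_form M (x0 + r * s, y0 + r * t) (x0 + r * s, y0 + r * t) = 0"
    if "s\<^sup>2 + t\<^sup>2 = 1" for s t
  proof -
    have "(x0 + r * s, y0 + r * t) \<in> sphere C r"
    proof -
      have "(r * s)\<^sup>2 + (r * t)\<^sup>2 = r\<^sup>2" using that by algebra
      then show ?thesis using assms(1) by (simp add: C dist_norm norm_Pair)
    qed
    then show ?thesis unfolding K by simp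
  qed
  \<comment> \<open>coefficients of the polynomial with respect to coordinates centred at \<open>C\<close>\<close>
  define A where "A = M$1$1"
  define D where "D = A * x0 + M$1$2 * y0 + M$1$3"
  define F where "F = M$1$2 * x0 + M$2$2 * y0 + M$2$3"
  define G where "G = polar_form M (x0, y0) (x0, y0)"
  have gen: "A * r\<^sup>2 * s\<^sup>2 + 2 * M$1$2 * r\<^sup>2 * s * t + M$2$2 * r\<^sup>2 * t\<^sup>2
      + 2 * D * r * s + 2 * F * r * t + G = 0" if "s\<^sup>2 + t\<^sup>2 = 1" for s t
    using on[OF that] unfolding G_def D_def F_def polar_form_coords sym A_def
    by (simp add: power2_eq_square algebra_simps)
  have "A * r\<^sup>2 + 2 * D * r + G = 0" "A * r\<^sup>2 - 2 * D * r + G = 0"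
    using gen[of 1 0] gen[of "-1" 0] by simp_all
  then have "D * r = 0" by linarith
  then have D0: "D = 0" using assms(1) by simp
  have "M$2$2 * r\<^sup>2 + 2 * F * r + G = 0" "M$2$2 * r\<^sup>2 - 2 * F * r + G = 0"
    using gen[of 0 1] gen[of 0 "-1"] by simp_all
  then have "F * r = 0" by linarith
  then have F0: "F = 0" using assms(1) by simp
  have G: "G = - A * r\<^sup>2" using gen[of 1 0] D0 by simp
  have "M$2$2 * r\<^sup>2 = A * r\<^sup>2" using gen[of 0 1] F0 G by simp
  then have M22: "M$2$2 = A" using assms(1) by simp
  \<comment> \<open>a fifth point, off the axes, with rational coordinates\<close>
  have "2 * M$1$2 * r\<^sup>2 * (3/5) * (4/5) = 0"
    using gen[of "3/5" "4/5"] unfolding D0 F0 G M22 by (simp add: power2_eq_square field_simps)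
  then have M12: "M$1$2 = 0" using assms(1) by simp
  have eq: "polar_form M z p = A * ((z - C) \<bullet> (p - C) - r\<^sup>2)" for z p
  proof -
    obtain x y x' y' where [simp]: "z = (x, y)" "p = (x', y')" by (metis surj_pair)
    have M13: "M$1$3 = - A * x0" using D0 M12 unfolding D_def by simp
    have M23: "M$2$3 = - A * y0" using F0 M12 M22 unfolding F_def by simp
    have M33: "M$3$3 = A * (x0\<^sup>2 + y0\<^sup>2 - r\<^sup>2)"
      using G unfolding G_def polar_form_coords sym M12 M13 M23 M22 A_def[symmetric]
      by (simp add: power2_eq_square algebra_simps)
    show ?thesis
      by (simp add: polar_form_coords C sym M12 M13 M23 M22 M33 A_def[symmetric]
          power2_eq_square algebra_simps)
  qed
  \<comment> \<open>otherwise the centre would lie on the circle\<close>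
  have "A \<noteq> 0"
  proof
    assume "A = 0"
    then have "C \<in> sphere C r" unfolding K by (simp add: eq)
    then show False using assms(1) by simp
  qed
  then show ?thesis using that eq by blast
qed

text \<open>
  The vector \<open>n\<close> is the outer unit normal at the point of contact \<open>C + r *\<^sub>R n\<close>.
\<close>

lemma tangent_line_sphere_iff:
  assumes "r > 0"
  shows "tangent_line (sphere C r) L \<longleftrightarrow> (\<exists>n. norm n = 1 \<and> L = {z. n \<bullet> (z - C) = r})"
proof
  assume "tangent_line (sphere C r) L"
  then obtain M p where M: "conic_matrix M (sphere C r)" and p: "p \<in> sphere C r"
    and L: "L = {z. polar_form M z p = 0}"
    by (auto simp: tangent_line_def polar_form_def)
  obtain k where k: "k \<noteq> 0" "\<And>z p. polar_form M z p = k * ((z - C) \<bullet> (p - C) - r\<^sup>2)"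
    using conic_matrix_circle_unique[OF assms M] by blast
  define n where "n = (1 / r) *\<^sub>R (p - C)"
  have "norm n = 1"
    using p assms by (simp add: n_def dist_norm norm_minus_commute)
  moreover have "L = {z. n \<bullet> (z - C) = r}"
  proof -
    have "n \<bullet> (z - C) = r \<longleftrightarrow> (z - C) \<bullet> (p - C) - r\<^sup>2 = 0" for z
      using assms by (simp add: n_def power2_eq_square inner_commute
          divide_eq_eq del: scaleR_right_diff_distrib)
    then show ?thesis using k by (simp add: L)
  qed
  ultimately show "\<exists>n. norm n = 1 \<and> L = {z. n \<bullet> (z - C) = r}" by blast
next
  assume "\<exists>n. norm n = 1 \<and> L = {z. n \<bullet> (z - C) = r}"
  then obtain n where n: "norm n = 1" and L: "L = {z. n \<bullet> (z - C) = r}" by blast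
  define p where "p = C + r *\<^sub>R n"
  have "p \<in> sphere C r" using n assms by (simp add: p_def dist_norm)
  moreover have "L = {z. polar_form (circle_matrix C r) z p = 0}"
    using assms by (auto simp: L polar_form_circle_matrix p_def power2_eq_square inner_commute)
  ultimately show "tangent_line (sphere C r) L"
    unfolding tangent_line_def using conic_matrix_circle[OF assms]
    by (fastforce simp: polar_form_def)
qed

lemma tangent_line_sphere_affine_hull_iff:
  assumes "r > 0" "P \<noteq> Q"
  shows "tangent_line (sphere C r) (affine hull {P, Q}) \<longleftrightarrow>
    (\<exists>n. norm n = 1 \<and> n \<bullet> (P - C) = r \<and> n \<bullet> (Q - C) = r)"
proof
  assume "tangent_line (sphere C r) (affine hull {P, Q})"
  then obtain n where n: "norm n = 1" and L: "affine hull {P, Q} = {z. n \<bullet> (z - C) = r}"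
    using tangent_line_sphere_iff[OF assms(1)] by blast
  have "P \<in> affine hull {P, Q}" "Q \<in> affine hull {P, Q}" by (simp_all add: hull_inc)
  then show "\<exists>n. norm n = 1 \<and> n \<bullet> (P - C) = r \<and> n \<bullet> (Q - C) = r"
    using n unfolding L by blast
next
  assume "\<exists>n. norm n = 1 \<and> n \<bullet> (P - C) = r \<and> n \<bullet> (Q - C) = r"
  then obtain n where n: "norm n = 1" "n \<bullet> (P - C) = r" "n \<bullet> (Q - C) = r" by blast
  moreover from n(1) have "n \<noteq> 0" by auto
  ultimately have "affine hull {P, Q} = {z. n \<bullet> (z - C) = r}"
    using affine_hull_2_eq_line[OF assms(2)] by blast
  then show "tangent_line (sphere C r) (affine hull {P, Q})"
    unfolding tangent_line_sphere_iff[OF assms(1)] using n(1) by blast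
qed

section \<open>An ellipse seen from its focus\<close>

text \<open>
  The classical description of an ellipse by a focus: both sides become polynomial after squaring, and
  the right-hand side is nonnegative on the ellipse because \<open>c < a\<close>.
\<close>

lemma ellipse_iff_focus_distance:
  assumes "a > b" "b > 0" "c = sqrt (a\<^sup>2 - b\<^sup>2)"
  shows "P \<in> ellipse a b \<longleftrightarrow>
    norm (P - (c, 0)) = b\<^sup>2 / a - c / a * fst (P - (c, 0))"
proof -
  obtain x y where P: "P = (x, y)" by (cases P)
  have "b\<^sup>2 < a\<^sup>2" using assms by (intro power_strict_mono) auto
  then have c2: "c\<^sup>2 = a\<^sup>2 - b\<^sup>2" and "c \<ge> 0" using assms(3) by auto
  have "c < a" using c2 assms(1,2) by (auto intro: power2_less_imp_less[of c a])
  define d where "d = (a\<^sup>2 - c * x) / a"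
  have d: "b\<^sup>2 / a - c / a * (x - c) = d"
  proof -
    have "b\<^sup>2 - c * (x - c) = a\<^sup>2 - c * x" using c2 by (simp add: power2_eq_square algebra_simps)
    then show ?thesis by (simp add: d_def flip: diff_divide_distrib)
  qed
  have "(x - c)\<^sup>2 + y\<^sup>2 - d\<^sup>2 = b\<^sup>2 * ((x / a)\<^sup>2 + (y / b)\<^sup>2 - 1)"
  proof -
    have "a\<^sup>2 * ((x - c)\<^sup>2 + y\<^sup>2) - (a\<^sup>2 - c * x)\<^sup>2 = b\<^sup>2 * x\<^sup>2 + a\<^sup>2 * y\<^sup>2 - a\<^sup>2 * b\<^sup>2"
      using c2 by algebra
    then show ?thesis
      using assms(1,2) by (simp add: d_def power_divide divide_simps) (simp add: algebra_simps)
  qed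
  then have "(x - c)\<^sup>2 + y\<^sup>2 = d\<^sup>2 \<longleftrightarrow> b\<^sup>2 * ((x / a)\<^sup>2 + (y / b)\<^sup>2 - 1) = 0" by linarith
  then have on: "P \<in> ellipse a b \<longleftrightarrow> (x - c)\<^sup>2 + y\<^sup>2 = d\<^sup>2"
    using assms(2) by (simp add: P ellipse_def)
  have nrm: "norm (P - (c, 0)) = sqrt ((x - c)\<^sup>2 + y\<^sup>2)" by (simp add: P norm_Pair)
  have "d \<ge> 0" if "P \<in> ellipse a b"
  proof -
    have "(x / a)\<^sup>2 + (y / b)\<^sup>2 = 1" using that by (simp add: P ellipse_def)
    then have "(x / a)\<^sup>2 \<le> 1\<^sup>2" using zero_le_power2[of "y / b"] unfolding one_power2 by linarith
    then have "x / a \<le> 1" by (rule power2_le_imp_le) simp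
    then have "x \<le> a" using assms(1,2) by simp
    then have "c * x \<le> c * a" using \<open>c \<ge> 0\<close> by (rule mult_left_mono)
    also have "\<dots> \<le> a * a" using \<open>c < a\<close> assms(1,2) by (intro mult_right_mono) auto
    finally show ?thesis using assms(1,2) by (simp add: d_def power2_eq_square)
  qed
  moreover have "sqrt ((x - c)\<^sup>2 + y\<^sup>2) = d \<longleftrightarrow> d \<ge> 0 \<and> (x - c)\<^sup>2 + y\<^sup>2 = d\<^sup>2"
    by (metis real_sqrt_ge_0_iff real_sqrt_pow2 real_sqrt_unique sum_power2_ge_zero)
  moreover have "fst (P - (c, 0)) = x - c" by (simp add: P)
  ultimately show ?thesis unfolding nrm using on d by metis
qed

text \<open>
  The ellipse with eccentricity \<open>e\<close> and semi-latus rectum \<open>p\<close>, described from its focus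
  at the origin, together with the circle of radius \<open>r\<close> about this focus. When points of the
  ellipse are replaced by their directions, the circle is replaced by a conic with a focus at the
  origin; the two equations express that its other focus is \<open>(h, 0)\<close> and that its
  major axis has length \<open>1\<close>.
\<close>

locale focal_ellipse =
  fixes e p h r :: real
  assumes e_pos: "0 < e" and e_less: "e < 1" and p_pos: "0 < p" and h_pos: "0 < h"
    and h_eq: "e * h\<^sup>2 + 2 * h = e" and r_eq: "r * e = h * p"
begin

text \<open>
  The orthocentre of a triangle inscribed in a circle about the origin is the sum of its vertices.
  This point is the orthocentre of the directions of every triangle in the family.
\<close>

definition orthocentre :: point where "orthocentre = (h, 0)"

text \<open>
  The polar equation of the ellipse with respect to its focus: \<open>radial u\<close> is the point of the ellipse
  in direction \<open>u\<close>.
\<close>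

definition radial :: "point \<Rightarrow> point" where
  "radial u = (p / (1 + e * fst u)) *\<^sub>R u"

lemma h_less_1: "h < 1"
proof -
  have "2 * h \<le> e" using h_eq e_pos by (smt (verit) mult_nonneg_nonneg zero_le_power2)
  then show ?thesis using e_less by simp
qed

lemma norm_orthocentre: "norm orthocentre = h"
  using h_pos by (simp add: orthocentre_def norm_Pair)

lemma r_pos: "r > 0"
  using r_eq e_pos h_pos p_pos by (metis mult_pos_pos zero_less_mult_pos2)

lemma denominator_pos:
  assumes "norm u = 1"
  shows "1 + e * fst u > 0"
proof -
  have "\<bar>fst u\<bar> \<le> 1" using norm_fst_le[of "fst u" "snd u"] assms by simp
  then have "- fst u * e \<le> 1 * e" using e_pos by (intro mult_right_mono) auto
  then show ?thesis using e_less by (simp add: mult.commute)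
qed

lemma norm_radial:
  assumes "norm u = 1"
  shows "norm (radial u) = p - e * fst (radial u)"
  using denominator_pos[OF assms] p_pos assms by (simp add: radial_def field_simps)

lemma radial_surj:
  assumes "norm X = p - e * fst X"
  obtains u where "norm u = 1" "X = radial u"
proof
  have "X \<noteq> 0" using assms p_pos by auto
  then show "norm (sgn X) = 1" by (simp add: norm_sgn)
  have "1 + e * fst (sgn X) = p / norm X"
    using assms \<open>X \<noteq> 0\<close> by (simp add: sgn_div_norm field_simps)
  then show "X = radial (sgn X)"
    using \<open>X \<noteq> 0\<close> p_pos by (simp add: radial_def sgn_div_norm)
qed

text \<open>
  The position of a point of the ellipse relative to the line \<open>n \<bullet> z = r\<close> is that of its
  direction relative to the line at level \<open>r\<close> with normal \<open>p *\<^sub>R n - (r * e, 0)\<close>, because the two expressions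
  differ by a positive factor. This is how lines are transported from the ellipse to the unit circle.
\<close>

lemma
  assumes "norm u = 1"
  shows inner_radial_eq_iff: "n \<bullet> radial u = r \<longleftrightarrow> (p *\<^sub>R n - (r * e, 0)) \<bullet> u = r"
    and inner_radial_less_iff: "n \<bullet> radial u < r \<longleftrightarrow> (p *\<^sub>R n - (r * e, 0)) \<bullet> u < r"
proof -
  have "n \<bullet> radial u = p * (n \<bullet> u) / (1 + e * fst u)" by (simp add: radial_def)
  moreover have "(p *\<^sub>R n - (r * e, 0)) \<bullet> u = p * (n \<bullet> u) - r * e * fst u"
    by (cases u) (simp add: inner_diff_left)
  ultimately have *: "n \<bullet> radial u - r = ((p *\<^sub>R n - (r * e, 0)) \<bullet> u - r) / (1 + e * fst u)"
    using denominator_pos[OF assms] by (simp add: field_simps)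
  have "n \<bullet> radial u - r = 0 \<longleftrightarrow> (p *\<^sub>R n - (r * e, 0)) \<bullet> u - r = 0"
    "n \<bullet> radial u - r < 0 \<longleftrightarrow> (p *\<^sub>R n - (r * e, 0)) \<bullet> u - r < 0"
    unfolding * using denominator_pos[OF assms] by (auto simp: divide_less_0_iff)
  then show "n \<bullet> radial u = r \<longleftrightarrow> (p *\<^sub>R n - (r * e, 0)) \<bullet> u = r"
    "n \<bullet> radial u < r \<longleftrightarrow> (p *\<^sub>R n - (r * e, 0)) \<bullet> u < r"
    by (simp_all only: diff_less_0_iff_less right_minus_eq)
qed

lemma norm_diff_orthocentre: "(norm (orthocentre - w))\<^sup>2 = w \<bullet> w - 2 * h * fst w + h\<^sup>2"
  unfolding power2_norm_eq_inner by (cases w) (simp add: orthocentre_def power2_eq_square algebra_simps)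

text \<open>
  The radius through the midpoint of a chord of the unit circle is perpendicular to the chord.
\<close>

lemma inner_diff_add_units:
  fixes u v :: point
  assumes "norm u = 1" "norm v = 1"
  shows "(u - v) \<bullet> (u + v) = 0"
  using assms by (simp add: norm_eq_1 inner_diff_left inner_diff_right inner_add_right inner_commute)

text \<open>
  Here \<open>w\<close> stands for the sum of the directions of two vertices. The line through these directions
  consists of the \<open>z\<close> with \<open>w \<bullet> z = w \<bullet> w / 2\<close>, which on scaling its normal becomes
  \<open>((2 * r / (w \<bullet> w)) *\<^sub>R w) \<bullet> z = r\<close>; so \<open>n\<close> is the normal of the corresponding chord of the ellipse,
  scaled so that the chord is \<open>n \<bullet> z = r\<close>. The chord is tangent to the circle if \<open>n\<close> is a
  unit vector, and the choice of \<open>h\<close> and \<open>r\<close> turns this into the mirror image criterion for the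
  tangents of a conic with foci \<open>0\<close> and \<open>orthocentre\<close>.
\<close>

lemma unit_normal_iff:
  assumes "w \<bullet> w > 0" "p *\<^sub>R n = (2 * r / (w \<bullet> w)) *\<^sub>R w + (r * e, 0)"
  shows "norm n = 1 \<longleftrightarrow> norm (orthocentre - w) = 1"
proof -
  define s where "s = w \<bullet> w"
  have "(p *\<^sub>R n) \<bullet> (p *\<^sub>R n) = 4 * r\<^sup>2 / s + 4 * r\<^sup>2 * e * fst w / s + (r * e)\<^sup>2"
  proof -
    have "(k *\<^sub>R w + (f, 0)) \<bullet> (k *\<^sub>R w + (f, 0)) = k\<^sup>2 * s + 2 * k * f * fst w + f\<^sup>2" for k f
      by (cases w) (simp add: s_def power2_eq_square algebra_simps)
    then show ?thesis
      unfolding assms(2) s_def[symmetric] using assms(1)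
      by (simp add: power2_eq_square flip: s_def)
  qed
  then have "e\<^sup>2 * (p\<^sup>2 * (n \<bullet> n)) * s = 4 * (r * e)\<^sup>2 * (1 + e * fst w) + e\<^sup>2 * (r * e)\<^sup>2 * s"
    using assms(1) unfolding s_def[symmetric] by (simp add: power2_eq_square field_simps)
  then have "p\<^sup>2 * (e\<^sup>2 * (n \<bullet> n) * s) = p\<^sup>2 * (4 * h\<^sup>2 * (1 + e * fst w) + e\<^sup>2 * h\<^sup>2 * s)"
    unfolding r_eq by (simp add: power2_eq_square algebra_simps)
  then have "e\<^sup>2 * (n \<bullet> n) * s = 4 * h\<^sup>2 * (1 + e * fst w) + e\<^sup>2 * h\<^sup>2 * s"
    using p_pos by simp
  \<comment> \<open>the equation \<open>e * h\<^sup>2 + 2 * h = e\<close> makes the two defects proportional\<close>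
  then have "e\<^sup>2 * s * (n \<bullet> n - 1) = 2 * h * e * (1 - (norm (orthocentre - w))\<^sup>2)"
    using h_eq unfolding norm_diff_orthocentre s_def[symmetric] by algebra
  then have "n \<bullet> n = 1 \<longleftrightarrow> (norm (orthocentre - w))\<^sup>2 = 1"
    using assms(1) e_pos h_pos by (auto simp: s_def)
  then show ?thesis by (simp add: norm_eq_1 power2_eq_1_iff) (smt (verit) norm_ge_zero)
qed

text \<open>
  The transported normal \<open>V\<close> is perpendicular to the chord of directions, hence a multiple of \<open>u + v\<close>,
  and its multiple is fixed by \<open>V \<bullet> u = r\<close>.
\<close>

lemma chord_tangent_imp:
  assumes "norm u = 1" "norm v = 1" "u \<noteq> v"
    and "norm n = 1" "n \<bullet> radial u = r" "n \<bullet> radial v = r"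
  shows "norm (orthocentre - (u + v)) = 1"
proof -
  define V where "V = p *\<^sub>R n - (r * e, 0)"
  define w where "w = u + v"
  have V: "V \<bullet> u = r" "V \<bullet> v = r"
    using assms inner_radial_eq_iff unfolding V_def by blast+
  then have Vw: "V \<bullet> w = 2 * r" by (simp add: w_def inner_add_right)
  then have "w \<noteq> 0" using r_pos by auto
  have "(u - v) \<bullet> V = 0" using V by (simp add: inner_commute inner_diff_right)
  moreover have "(u - v) \<bullet> w = 0" using inner_diff_add_units assms(1,2) by (simp add: w_def)
  ultimately obtain t where t: "V = t *\<^sub>R w"
    using parallel_if_orthogonal_to_same[of "u - v" V w] assms(3) \<open>w \<noteq> 0\<close> by auto
  have "w \<bullet> w > 0" using \<open>w \<noteq> 0\<close> by simp
  moreover have "t = 2 * r / (w \<bullet> w)" using Vw \<open>w \<bullet> w > 0\<close> t by (simp add: field_simps)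
  ultimately show ?thesis
    using unit_normal_iff[of w n] t assms(4) by (simp add: V_def w_def algebra_simps)
qed

text \<open>
  The second vertices of the two tangent chords from \<open>w\<close> lie on the unit circle and on the unit
  circle about \<open>d = orthocentre - w\<close>. These circles meet in at most two points, symmetric about the
  midpoint of \<open>0\<close> and \<open>d\<close>, so distinct \<open>u\<close> and \<open>v\<close> add up to \<open>d\<close>.
\<close>

lemma sum_eq_orthocentre:
  assumes "norm u = 1" "norm v = 1" "norm w = 1" "u \<noteq> v"
    and "norm (orthocentre - (u + w)) = 1" "norm (orthocentre - (v + w)) = 1"
  shows "u + v + w = orthocentre"
proof -
  define d where "d = orthocentre - w"
  have "d \<noteq> 0" using norm_orthocentre h_less_1 assms(3) by (auto simp: d_def)
  have "2 * (d \<bullet> x) = d \<bullet> d" if "norm x = 1" "norm (orthocentre - (x + w)) = 1" for x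
  proof -
    have "norm (d - x) = 1" using that(2) by (simp add: d_def algebra_simps)
    then show ?thesis using that(1) by (simp add: norm_eq_1 algebra_simps inner_commute)
  qed
  then have du: "2 * (d \<bullet> u) = d \<bullet> d" and dv: "2 * (d \<bullet> v) = d \<bullet> d" using assms by auto
  have "(u - v) \<bullet> (u + v) = 0" using inner_diff_add_units assms(1,2) by simp
  moreover have "(u - v) \<bullet> d = 0" using du dv by (simp add: inner_commute inner_diff_right)
  ultimately obtain t where t: "u + v = t *\<^sub>R d"
    using parallel_if_orthogonal_to_same[of "u - v" "u + v" d] assms(4) \<open>d \<noteq> 0\<close> by auto
  have "t * (d \<bullet> d) = d \<bullet> (u + v)" unfolding t by simp
  also have "\<dots> = d \<bullet> d" using du dv by (simp add: inner_add_right)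
  finally have "u + v = d" using \<open>d \<noteq> 0\<close> t by simp
  then show ?thesis by (simp add: d_def)
qed

text \<open>
  The points \<open>u\<close> and \<open>v\<close> are the intersections of the unit circles about \<open>0\<close> and about
  \<open>d = orthocentre - w\<close>, which meet because \<open>d\<close> is nonzero
  and has norm at most \<open>1 + h < 2\<close>.
\<close>

lemma ex_sum_eq_orthocentre:
  assumes "norm w = 1"
  obtains u v where "norm u = 1" "norm v = 1" "u + v + w = orthocentre"
proof -
  define d where "d = orthocentre - w"
  define s where "s = d \<bullet> d"
  obtain d1 d2 where d: "d = (d1, d2)" by (cases d)
  have "d \<noteq> 0" using norm_orthocentre h_less_1 assms by (auto simp: d_def)
  then have "s > 0" by (simp add: s_def)
  have "norm d \<le> 2"
    using norm_triangle_ineq4[of orthocentre w] norm_orthocentre h_less_1 assms by (simp add: d_def)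
  then have "s \<le> 4" using power_mono[of "norm d" 2 2] by (simp add: s_def power2_norm_eq_inner)
  \<comment> \<open>half the length of the common chord, relative to the distance of the centres\<close>
  define k where "k = sqrt (1 / s - 1 / 4)"
  have "k\<^sup>2 = 1 / s - 1 / 4" using \<open>s > 0\<close> \<open>s \<le> 4\<close> by (simp add: k_def field_simps)
  then have k: "s / 4 + k\<^sup>2 * s = 1" using \<open>s > 0\<close> by (simp add: field_simps)
  define u where "u = (d1 / 2 - k * d2, d2 / 2 + k * d1)"
  define v where "v = (d1 / 2 + k * d2, d2 / 2 - k * d1)"
  have "u \<bullet> u = s / 4 + k\<^sup>2 * s" "v \<bullet> v = s / 4 + k\<^sup>2 * s"
    by (simp_all add: u_def v_def s_def d power2_eq_square field_simps)
  then have "norm u = 1" "norm v = 1" using k by (simp_all add: norm_eq_1)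
  moreover have "u + v = d" by (simp add: u_def v_def d)
  then have "u + v + w = orthocentre" by (simp add: d_def)
  ultimately show ?thesis using that by blast
qed

text \<open>
  The third vertex of the triangle lies on the same side of the tangent chord as the circle. With
  \<open>m = u + v\<close> one finds \<open>2 * (m \<bullet> w) = h\<^sup>2 - 1 - m \<bullet> m\<close>, which is negative because \<open>h < 1\<close>:
  the direction \<open>w\<close> points away from the chord, as in an acute triangle.
\<close>

lemma supporting_normal:
  assumes "norm u = 1" "norm v = 1" "norm w = 1" "u + v + w = orthocentre"
  obtains n where "norm n = 1" "n \<bullet> radial u = r" "n \<bullet> radial v = r" "n \<bullet> radial w < r"
proof
  define m where "m = u + v"
  define s where "s = m \<bullet> m"
  define V where "V = (2 * r / s) *\<^sub>R m"
  define n where "n = (1 / p) *\<^sub>R (V + (r * e, 0))"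
  have w: "w = orthocentre - m" using assms(4) by (auto simp: m_def algebra_simps)
  have nm: "norm (orthocentre - m) = 1" using assms(3) w by simp
  have h2: "h\<^sup>2 < 1" using h_pos h_less_1 by (simp add: power_less_one_iff)
  have "m \<noteq> 0" using nm norm_orthocentre h_less_1 by auto
  then have "s > 0" by (simp add: s_def)
  have pn: "p *\<^sub>R n = V + (r * e, 0)" using p_pos by (simp add: n_def)
  then have V: "V = p *\<^sub>R n - (r * e, 0)" by simp
  show "norm n = 1" using unit_normal_iff[of m n] \<open>s > 0\<close> pn nm by (simp add: V_def s_def)
  have "2 * (m \<bullet> u) = s" "2 * (m \<bullet> v) = s"
    using assms(1,2) by (simp_all add: m_def s_def norm_eq_1 algebra_simps inner_commute)
  then have "V \<bullet> u = r" "V \<bullet> v = r" using \<open>s > 0\<close> by (simp_all add: V_def field_simps)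
  then show "n \<bullet> radial u = r" "n \<bullet> radial v = r"
    using assms(1,2) inner_radial_eq_iff unfolding V by blast+
  have "2 * (m \<bullet> w) = h\<^sup>2 - 1 - s"
    using norm_diff_orthocentre[of m] nm unfolding w s_def
    by (cases m) (simp add: orthocentre_def power2_eq_square algebra_simps)
  then have "m \<bullet> w < 0" using h2 \<open>s > 0\<close> by simp
  then have "V \<bullet> w < 0" using r_pos \<open>s > 0\<close> by (simp add: V_def divide_less_0_iff mult_less_0_iff)
  then have "V \<bullet> w < r" using r_pos by simp
  then show "n \<bullet> radial w < r" using assms(3) inner_radial_less_iff unfolding V by blast
qed

text \<open>
  The condition on the directions is symmetric, so each side has a supporting normal. The strict
  inequality for the opposite vertex shows that the triangle is not degenerate.
\<close>

lemma triangle_of_sum_eq_orthocentre: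
  fixes C :: point
  assumes "norm u = 1" "norm v = 1" "norm w = 1" "u + v + w = orthocentre"
  defines "T \<equiv> {C + radial u, C + radial v, C + radial w}"
  shows "triangle T" "sidelines_tangent T (sphere C r)" "sphere C r \<subseteq> convex hull T"
proof -
  have perm: "v + w + u = orthocentre" "w + u + v = orthocentre" using assms(4) by (simp_all add: add_ac)
  obtain l where l: "norm l = 1" "l \<bullet> radial v = r" "l \<bullet> radial w = r" "l \<bullet> radial u < r"
    using supporting_normal[of v w u] assms perm by auto
  obtain m where m: "norm m = 1" "m \<bullet> radial w = r" "m \<bullet> radial u = r" "m \<bullet> radial v < r"
    using supporting_normal[of w u v] assms perm by auto
  obtain n where n: "norm n = 1" "n \<bullet> radial u = r" "n \<bullet> radial v = r" "n \<bullet> radial w < r"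
    using supporting_normal[of u v w] assms by auto
  have neq: "radial u \<noteq> radial v" "radial u \<noteq> radial w" "radial v \<noteq> radial w"
    using l m n by auto
  have "n \<noteq> 0" using n(1) by auto
  have "C + radial w \<notin> affine hull {C + radial u, C + radial v}"
    using affine_hull_2_eq_line[of "C + radial u" "C + radial v" n C r] neq(1) \<open>n \<noteq> 0\<close> n by simp
  then have nc: "\<not> collinear T"
    using neq(1) by (simp add: T_def collinear_3_affine_hull)
  then show "triangle T" using neq by (auto simp: triangle_def T_def)
  show "sidelines_tangent T (sphere C r)"
    unfolding sidelines_tangent_def
  proof (intro ballI impI)
    fix P Q assume PQ: "P \<in> T" "Q \<in> T" "P \<noteq> Q"
    have "\<exists>k\<in>{l, m, n}. k \<bullet> (P - C) = r \<and> k \<bullet> (Q - C) = r"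
      using PQ l m n unfolding T_def by auto
    then have "\<exists>n. norm n = 1 \<and> n \<bullet> (P - C) = r \<and> n \<bullet> (Q - C) = r"
      using l(1) m(1) n(1) by blast
    then show "tangent_line (sphere C r) (affine hull {P, Q})"
      using tangent_line_sphere_affine_hull_iff[OF r_pos PQ(3)] by blast
  qed
  have "cball C r \<subseteq> convex hull T"
    unfolding T_def by (rule cball_subset_convex_hull_3[of _ _ _ l _ _ m n])
      (use nc l m n in \<open>simp_all add: T_def\<close>)
  then show "sphere C r \<subseteq> convex hull T" using sphere_cball by blast
qed

text \<open>
  The two sides through the vertex with direction \<open>w\<close> determine the sum of the directions
  by \<open>sum_eq_orthocentre\<close>.
\<close>

lemma sum_eq_orthocentre_of_triangle:
  assumes "triangle T" "sidelines_tangent T (sphere C r)"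
    and on: "\<And>P. P \<in> T \<Longrightarrow> norm (P - C) = p - e * fst (P - C)"
  obtains u v w where "norm u = 1" "norm v = 1" "norm w = 1" "u + v + w = orthocentre"
    "T = {C + radial u, C + radial v, C + radial w}"
proof -
  obtain P Q S where T: "T = {P, Q, S}" and ne: "P \<noteq> Q" "P \<noteq> S" "Q \<noteq> S"
    using assms(1) by (auto simp: triangle_def card_3_iff)
  obtain u where u: "norm u = 1" "P - C = radial u" using radial_surj on[of P] T by blast
  obtain v where v: "norm v = 1" "Q - C = radial v" using radial_surj on[of Q] T by blast
  obtain w where w: "norm w = 1" "S - C = radial w" using radial_surj on[of S] T by blast
  have uvw: "u \<noteq> v" "u \<noteq> w" "v \<noteq> w" using ne u(2) v(2) w(2) by (metis diff_add_cancel)+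
  have chord: "norm (orthocentre - (x + y)) = 1"
    if "X \<in> T" "Y \<in> T" "X \<noteq> Y" "norm x = 1" "X - C = radial x" "norm y = 1" "Y - C = radial y"
      "x \<noteq> y" for X Y x y
  proof -
    have "tangent_line (sphere C r) (affine hull {X, Y})"
      using assms(2) that unfolding sidelines_tangent_def by blast
    then obtain n where "norm n = 1" "n \<bullet> (X - C) = r" "n \<bullet> (Y - C) = r"
      using tangent_line_sphere_affine_hull_iff[OF r_pos \<open>X \<noteq> Y\<close>] by blast
    then show ?thesis using chord_tangent_imp that by simp
  qed
  have "u + v + w = orthocentre"
  proof (rule sum_eq_orthocentre)
    show "norm (orthocentre - (u + w)) = 1" by (rule chord[of P S]) (use T ne u w uvw in auto)
    show "norm (orthocentre - (v + w)) = 1" by (rule chord[of Q S]) (use T ne v w uvw in auto)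
  qed (use u v w uvw in auto)
  moreover have "T = {C + radial u, C + radial v, C + radial w}"
    using T by (simp flip: u(2) v(2) w(2))
  ultimately show ?thesis using that u v w by blast
qed

end

section \<open>The circle about the focus as a caustic\<close>

theorem proposition1:
  fixes a b c r1 :: real
  assumes "a > b" and "b > 0"
    and "c = sqrt (a\<^sup>2 - b\<^sup>2)"
    and "r1 = b\<^sup>2 / c\<^sup>2 * (sqrt (a\<^sup>2 + c\<^sup>2) - a)"
  shows "poncelet_caustic (ellipse a b) (sphere (c, 0) r1) \<and>
    (\<forall>T \<in> poncelet_family (ellipse a b) (sphere (c, 0) r1).
       incircle T (sphere (c, 0) r1))"
proof -
  have "b\<^sup>2 < a\<^sup>2" using assms by (intro power_strict_mono) auto
  then have c2: "c\<^sup>2 = a\<^sup>2 - b\<^sup>2" and "c > 0" using assms(3) by auto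
  have "c < a" using c2 assms(1,2) by (auto intro: power2_less_imp_less[of c a])
  define q where "q = sqrt (a\<^sup>2 + c\<^sup>2)"
  have q2: "q\<^sup>2 = a\<^sup>2 + c\<^sup>2" by (simp add: q_def)
  have "q > a" using \<open>c > 0\<close> assms(1,2) by (simp add: q_def real_less_rsqrt)
  \<comment> \<open>\<open>(q - a) / c\<close> is the positive root of the quadratic equation for \<open>h\<close>\<close>
  interpret focal_ellipse "c / a" "b\<^sup>2 / a" "(q - a) / c" r1
  proof
    define k where "k = (q - a) / c"
    have "k * c = q - a" using \<open>c > 0\<close> by (simp add: k_def)
    then have "c * (c * k\<^sup>2 + 2 * a * k) = c * c" using q2 by algebra
    then have "c * k\<^sup>2 + 2 * a * k = c" using \<open>c > 0\<close> by simp
    then show "c / a * ((q - a) / c)\<^sup>2 + 2 * ((q - a) / c) = c / a"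
      unfolding k_def[symmetric] using assms(1,2) by (simp add: field_simps)
    show "r1 * (c / a) = (q - a) / c * (b\<^sup>2 / a)"
      using \<open>c > 0\<close> assms(1,2) unfolding assms(4) q_def[symmetric]
      by (simp add: divide_simps power2_eq_square)
  qed (use \<open>c > 0\<close> \<open>c < a\<close> \<open>q > a\<close> assms(1,2) in auto)
  let ?C = "(c, 0) :: point" and ?E = "ellipse a b"
  have E: "P \<in> ?E \<longleftrightarrow> norm (P - ?C) = b\<^sup>2 / a - c / a * fst (P - ?C)" for P
    by (rule ellipse_iff_focus_distance[OF assms(1,2,3)])
  have radial_E: "?C + radial u \<in> ?E" if "norm u = 1" for u
    unfolding E using norm_radial[OF that] by simp
  have "\<exists>T\<in>poncelet_family ?E (sphere ?C r1). P \<in> T" if "P \<in> ?E" for P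
  proof -
    have "norm (P - ?C) = b\<^sup>2 / a - c / a * fst (P - ?C)" using that E by blast
    then obtain w where w: "norm w = 1" "P - ?C = radial w" by (rule radial_surj)
    obtain u v where uv: "norm u = 1" "norm v = 1" "u + v + w = orthocentre"
      by (rule ex_sum_eq_orthocentre[OF w(1)])
    let ?T = "{?C + radial u, ?C + radial v, ?C + radial w}"
    have "?T \<in> poncelet_family ?E (sphere ?C r1)"
      unfolding poncelet_family_def
      using triangle_of_sum_eq_orthocentre(1,2)[OF uv(1,2) w(1) uv(3)] radial_E uv(1,2) w(1) by blast
    moreover have "P = ?C + radial w" using w(2) by (metis add.commute diff_add_cancel)
    then have "P \<in> ?T" by blast
    ultimately show ?thesis by (rule bexI[rotated])
  qed
  moreover have "conic_section (sphere ?C r1)"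
    using conic_matrix_circle[OF r_pos] unfolding conic_section_def by blast
  ultimately have "poncelet_caustic ?E (sphere ?C r1)" by (simp add: poncelet_caustic_def)
  moreover have "incircle T (sphere ?C r1)" if "T \<in> poncelet_family ?E (sphere ?C r1)" for T
  proof -
    have T: "triangle T" "T \<subseteq> ?E" "sidelines_tangent T (sphere ?C r1)"
      using that by (auto simp: poncelet_family_def)
    have on: "norm (P - ?C) = b\<^sup>2 / a - c / a * fst (P - ?C)" if "P \<in> T" for P
      using that T(2) E by blast
    obtain u v w where uvw: "norm u = 1" "norm v = 1" "norm w = 1" "u + v + w = orthocentre"
      and T_eq: "T = {?C + radial u, ?C + radial v, ?C + radial w}"
      by (rule sum_eq_orthocentre_of_triangle[OF T(1,3) on])
    have "sphere ?C r1 \<subseteq> convex hull T"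
      unfolding T_eq by (rule triangle_of_sum_eq_orthocentre(3)[OF uvw])
    then show ?thesis using T(3) r_pos unfolding incircle_def by blast
  qed
  ultimately show ?thesis by (intro conjI ballI)
qed

end
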